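(* Let $G$ be a group, and let $\operatorname{ad} : G \to \operatorname{Inn}(G) \hookrightarrow \operatorname{Aut}(G)$ denote the natural map, sending $g$ to the inner automorphism $\operatorname{ad}_g : x \mapsto gxg^{-1}$. Then for every homogeneous quasimorphism $f \in Q_h(\operatorname{Aut}(G))$, the pullback $\operatorname{ad}^* f := f \circ \operatorname{ad} \in Q_h(G)$ is an $\operatorname{Aut}(G)$-invariant homogeneous quasimorphism on $G$. It is zero if and only if $f$ vanishes identically on $\operatorname{Inn}(G)$.
   Context: A quasimorphism on a group $H$ is a function $f : H \to \mathbb{R}$ whose defect $D(f) := \sup_{g,h \in H} |f(g)+f(h)-f(gh)|$ is finite. It is homogeneous if its restriction to every cyclic subgroup is a homomorphism. $Q_h(H)$ denotes the real vector space of homogeneous quasimorphisms on $H$. A quasimorphism $f$ on $G$ is $\operatorname{Aut}$-invariant if $f \circ \phi = f$ for all $\phi \in \operatorname{Aut}(G)$. *)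

theory Defs
  imports "HOL-Library.Extended_Real" "HOL-Algebra.Bij" "HOL-Algebra.Elementary_Groups"
begin

text \<open>
  As for \<^const>\<open>hom\<close>, functions on a group are total functions of which only the values on the
  carrier matter; in particular a function on \<open>H\<close> is zero iff it vanishes on \<open>carrier H\<close>.
\<close>

definition defect :: "('a, 'b) monoid_scheme \<Rightarrow> ('a \<Rightarrow> real) \<Rightarrow> ereal" where
  "defect H f =
    (SUP (g, h) \<in> carrier H \<times> carrier H. ereal \<bar>f g + f h - f (g \<otimes>\<^bsub>H\<^esub> h)\<bar>)"

definition quasimorphism :: "('a, 'b) monoid_scheme \<Rightarrow> ('a \<Rightarrow> real) \<Rightarrow> bool" where
  "quasimorphism H f \<longleftrightarrow> defect H f < \<infinity>"

definition real_group :: "real monoid" where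
  "real_group = \<lparr>carrier = UNIV, monoid.mult = (+), one = 0\<rparr>"

definition homogeneous :: "('a, 'b) monoid_scheme \<Rightarrow> ('a \<Rightarrow> real) \<Rightarrow> bool" where
  "homogeneous H f \<longleftrightarrow> (\<forall>x \<in> carrier H. f \<in> hom (subgroup_generated H {x}) real_group)"

definition Qh :: "('a, 'b) monoid_scheme \<Rightarrow> ('a \<Rightarrow> real) set" where
  "Qh H = {f. quasimorphism H f \<and> homogeneous H f}"

definition Aut_invariant :: "('a, 'b) monoid_scheme \<Rightarrow> ('a \<Rightarrow> real) \<Rightarrow> bool" where
  "Aut_invariant G f \<longleftrightarrow> (\<forall>\<phi> \<in> carrier (AutoGroup G). \<forall>x \<in> carrier G. (f \<circ> \<phi>) x = f x)"

text \<open>Elements of \<^const>\<open>AutoGroup\<close> are extensional, hence the restriction to the carrier.\<close>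

definition ad :: "('a, 'b) monoid_scheme \<Rightarrow> 'a \<Rightarrow> ('a \<Rightarrow> 'a)" where
  "ad G g = (\<lambda>x \<in> carrier G. g \<otimes>\<^bsub>G\<^esub> x \<otimes>\<^bsub>G\<^esub> inv\<^bsub>G\<^esub> g)"

definition Inn :: "('a, 'b) monoid_scheme \<Rightarrow> ('a \<Rightarrow> 'a) set" where
  "Inn G = ad G ` carrier G"

end

theory Submission
  imports Defs
begin

text \<open>
  Pulling back along any homomorphism preserves homogeneous quasimorphisms, and
  \<open>ad (\<phi> x) = \<phi> (ad x) \<phi>\<inverse>\<close> for every automorphism \<open>\<phi>\<close>. So invariance reduces to the fact
  that a homogeneous quasimorphism \<open>f\<close> is constant on conjugacy classes: since
  \<open>f (y\<inverse>) = - f y\<close>, the numbers \<open>f ((y x y\<inverse>)\<^sup>n) = n f (y x y\<inverse>)\<close> and \<open>f (x\<^sup>n) = n f x\<close>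
  differ by at most twice the defect, for all \<open>n\<close>.
\<close>

text \<open>Trades the supremum in \<open>ereal\<close> for a real bound that linear arithmetic can
  use.\<close>

lemma quasimorphism_iff_bounded:
  "quasimorphism H f \<longleftrightarrow>
    (\<exists>D. \<forall>g \<in> carrier H. \<forall>h \<in> carrier H. \<bar>f g + f h - f (g \<otimes>\<^bsub>H\<^esub> h)\<bar> \<le> D)"
proof
  assume "quasimorphism H f"
  then obtain n :: nat where "defect H f < ereal n"
    unfolding quasimorphism_def using less_PInf_Ex_of_nat by auto
  then have "defect H f \<le> ereal n"
    by simp
  then show "\<exists>D. \<forall>g \<in> carrier H. \<forall>h \<in> carrier H. \<bar>f g + f h - f (g \<otimes>\<^bsub>H\<^esub> h)\<bar> \<le> D"
    unfolding defect_def SUP_le_iff by (intro exI[of _ "real n"]) auto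
next
  assume "\<exists>D. \<forall>g \<in> carrier H. \<forall>h \<in> carrier H. \<bar>f g + f h - f (g \<otimes>\<^bsub>H\<^esub> h)\<bar> \<le> D"
  then obtain D where "\<And>g h. g \<in> carrier H \<Longrightarrow> h \<in> carrier H \<Longrightarrow> \<bar>f g + f h - f (g \<otimes>\<^bsub>H\<^esub> h)\<bar> \<le> D"
    by blast
  then have "defect H f \<le> ereal D"
    unfolding defect_def by (intro SUP_least) auto
  then show "quasimorphism H f"
    unfolding quasimorphism_def by (rule order.strict_trans1) simp
qed

text \<open>The subgroup generated by \<open>x\<close> consists of the integer powers of
  \<open>x\<close>, and these multiply by adding exponents, so a homomorphism on it is a function
  additive in the exponent.\<close>

lemma (in group) homogeneous_iff_int_pow:
  "homogeneous G f \<longleftrightarrow>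
    (\<forall>x \<in> carrier G. \<forall>m n :: int. f (x [^] (m + n)) = f (x [^] m) + f (x [^] n))"
  by (auto simp: homogeneous_def hom_def real_group_def carrier_subgroup_generated_by_singleton
      int_pow_mult)

lemma (in group_hom) quasimorphism_comp:
  assumes "quasimorphism H f"
  shows "quasimorphism G (f \<circ> h)"
  using assms unfolding quasimorphism_iff_bounded by (fastforce simp: hom_mult)

lemma (in group_hom) homogeneous_comp:
  assumes "homogeneous H f"
  shows "homogeneous G (f \<circ> h)"
  using assms by (simp add: G.homogeneous_iff_int_pow H.homogeneous_iff_int_pow hom_int_pow)

lemma (in group_hom) Qh_comp: "f \<in> Qh H \<Longrightarrow> f \<circ> h \<in> Qh G"
  by (simp add: Qh_def quasimorphism_comp homogeneous_comp)

context group
begin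

lemma homogeneous_one:
  assumes "homogeneous G f"
  shows "f \<one> = 0"
  using assms[unfolded homogeneous_iff_int_pow, rule_format, of \<one> 0 0] by simp

lemma homogeneous_inv:
  assumes "homogeneous G f" and "x \<in> carrier G"
  shows "f (inv x) = - f x"
  \<comment> \<open>The exponents \<open>1\<close> and \<open>- 1\<close> sum to \<open>0\<close>,
    so \<open>f x + f (inv x) = f \<one> = 0\<close>.\<close>
  using assms(1)[unfolded homogeneous_iff_int_pow, rule_format, of x 1 "- 1"] assms
  by (simp add: homogeneous_one int_pow_neg)

lemma homogeneous_nat_pow:
  assumes "homogeneous G f" and "x \<in> carrier G"
  shows "f (x [^] (n :: nat)) = real n * f x"
proof (induction n)
  case 0
  then show ?case
    using assms by (simp add: homogeneous_one)
next
  case (Suc n)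
  have "f (x [^] Suc n) = f (x [^] (int n + 1))"
    using int_pow_int[of G x "Suc n"] by (simp add: add.commute)
  also have "\<dots> = f (x [^] n) + f x"
    using assms by (simp add: homogeneous_iff_int_pow int_pow_int)
  finally show ?case
    using Suc.IH by (simp add: algebra_simps)
qed

lemma conj_nat_pow:
  assumes "x \<in> carrier G" and "y \<in> carrier G"
  shows "(y \<otimes> x \<otimes> inv y) [^] (n :: nat) = y \<otimes> x [^] n \<otimes> inv y"
proof (induction n)
  case (Suc n)
  \<comment> \<open>After right-nesting, the inner \<open>inv y\<close> and \<open>y\<close> are no
    longer directly multiplied together; this equation cancels them in that form.\<close>
  have "inv y \<otimes> (y \<otimes> (x \<otimes> inv y)) = x \<otimes> inv y"
    using assms by (simp flip: m_assoc)
  with assms Suc show ?case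
    by (simp add: m_assoc)
qed (use assms in simp)

lemma Qh_conj:
  assumes f: "f \<in> Qh G" and x: "x \<in> carrier G" and y: "y \<in> carrier G"
  shows "f (y \<otimes> x \<otimes> inv y) = f x"
proof (rule ccontr)
  have hom: "homogeneous G f"
    using f by (simp add: Qh_def)
  obtain D where D: "\<bar>f g + f h - f (g \<otimes> h)\<bar> \<le> D"
    if "g \<in> carrier G" and "h \<in> carrier G" for g h
    using f unfolding Qh_def quasimorphism_iff_bounded by blast
  \<comment> \<open>Each of the two products costs one defect, and \<open>f y\<close> cancels
    against \<open>f (inv y)\<close>. The error does not depend on \<open>z\<close>, so
    \<open>z\<close> may be any power of \<open>x\<close>.\<close>
  have near: "\<bar>f (y \<otimes> z \<otimes> inv y) - f z\<bar> \<le> 2 * D" if "z \<in> carrier G" for z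
    using D[of y z] D[of "y \<otimes> z" "inv y"] homogeneous_inv[OF hom y] that y by simp
  have bound: "real n * \<bar>f (y \<otimes> x \<otimes> inv y) - f x\<bar> \<le> 2 * D" for n
  proof -
    have "f (y \<otimes> x [^] n \<otimes> inv y) - f (x [^] n) = real n * (f (y \<otimes> x \<otimes> inv y) - f x)"
      using x y hom by (simp add: homogeneous_nat_pow right_diff_distrib flip: conj_nat_pow)
    with near[of "x [^] n"] x show ?thesis
      by (simp add: abs_mult)
  qed
  assume "f (y \<otimes> x \<otimes> inv y) \<noteq> f x"
  then obtain n where "2 * D < real n * \<bar>f (y \<otimes> x \<otimes> inv y) - f x\<bar>"
    using reals_Archimedean3[of "\<bar>f (y \<otimes> x \<otimes> inv y) - f x\<bar>"] by auto
  with bound[of n] show False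
    by simp
qed

lemma carrier_AutoGroup [simp]: "carrier (AutoGroup G) = auto G"
  by (simp add: AutoGroup_def)

lemma mult_AutoGroup:
  "\<phi> \<in> auto G \<Longrightarrow> \<psi> \<in> auto G \<Longrightarrow> \<phi> \<otimes>\<^bsub>AutoGroup G\<^esub> \<psi> = compose (carrier G) \<phi> \<psi>"
  by (simp add: AutoGroup_def BijGroup_def auto_def)

text \<open>The equality is one of total functions: off the carrier both sides are
  \<open>undefined\<close>.\<close>

lemma ad_mult:
  assumes "g \<in> carrier G" and "h \<in> carrier G"
  shows "ad G (g \<otimes> h) = compose (carrier G) (ad G g) (ad G h)"
  using assms by (auto simp: ad_def compose_def fun_eq_iff inv_mult_group m_assoc)

lemma ad_in_auto:
  assumes g: "g \<in> carrier G"
  shows "ad G g \<in> auto G"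
proof -
  \<comment> \<open>Keeping \<open>a\<close> and \<open>b\<close> general covers both composites of
    \<open>ad G g\<close> with its inverse \<open>ad G (inv g)\<close>.\<close>
  have cancel: "ad G a (ad G b x) = x"
    if "a \<otimes> b = \<one>" and "a \<in> carrier G" and "b \<in> carrier G" and "x \<in> carrier G" for a b x
  proof -
    have "ad G a (ad G b x) = ad G (a \<otimes> b) x"
      by (simp only: ad_mult[OF that(2,3)] compose_eq[OF that(4)])
    also have "\<dots> = x"
      using that by (simp add: ad_def)
    finally show ?thesis .
  qed
  have "bij_betw (ad G g) (carrier G) (carrier G)"
    by (rule bij_betw_byWitness[where f' = "ad G (inv g)"])
      (use g in \<open>auto simp: cancel\<close>, auto simp: ad_def)
  moreover have "ad G g (x \<otimes> y) = ad G g x \<otimes> ad G g y"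
    if "x \<in> carrier G" and "y \<in> carrier G" for x y
  proof -
    have "inv g \<otimes> (g \<otimes> (y \<otimes> inv g)) = y \<otimes> inv g"
      using that g by (simp flip: m_assoc)
    with that g show ?thesis
      by (simp add: ad_def m_assoc)
  qed
  moreover have "ad G g \<in> extensional (carrier G)"
    by (simp add: ad_def)
  ultimately show ?thesis
    by (auto simp: auto_def hom_def Bij_def bij_betw_imp_funcset)
qed

lemma group_hom_ad: "group_hom G (AutoGroup G) (ad G)"
  by (intro group_hom.intro group_hom_axioms.intro homI)
    (simp_all add: AutoGroup ad_in_auto ad_mult mult_AutoGroup)

lemma ad_auto_image:
  assumes \<phi>: "\<phi> \<in> auto G" and x: "x \<in> carrier G"
  shows "ad G (\<phi> x) = \<phi> \<otimes>\<^bsub>AutoGroup G\<^esub> ad G x \<otimes>\<^bsub>AutoGroup G\<^esub> inv\<^bsub>AutoGroup G\<^esub> \<phi>"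
proof -
  interpret A: group "AutoGroup G"
    by (rule AutoGroup)
  interpret \<phi>: group_hom G G \<phi>
    using \<phi> by unfold_locales (simp add: auto_def)
  have ads: "ad G x \<in> auto G" "ad G (\<phi> x) \<in> auto G"
    using x by (simp_all add: ad_in_auto)
  \<comment> \<open>At \<open>z\<close> both sides are
    \<open>\<phi> x \<otimes> \<phi> z \<otimes> inv (\<phi> x)\<close>. With \<open>\<phi>\<close>
    kept on the right, its inverse in \<open>AutoGroup G\<close> need not be computed.\<close>
  have "compose (carrier G) (ad G (\<phi> x)) \<phi> = compose (carrier G) \<phi> (ad G x)"
    using x by (auto simp: compose_def ad_def fun_eq_iff)
  then have "ad G (\<phi> x) \<otimes>\<^bsub>AutoGroup G\<^esub> \<phi> = \<phi> \<otimes>\<^bsub>AutoGroup G\<^esub> ad G x"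
    using \<phi> ads by (simp add: mult_AutoGroup)
  then show ?thesis
    using \<phi> ads A.inv_solve_right by (metis A.m_closed carrier_AutoGroup)
qed

end

theorem lemma2p3:
  fixes G :: "('a, 'b) monoid_scheme" and f :: "('a \<Rightarrow> 'a) \<Rightarrow> real"
  assumes "group G" and "f \<in> Qh (AutoGroup G)"
  shows "f \<circ> ad G \<in> Qh G \<and> Aut_invariant G (f \<circ> ad G) \<and>
    ((\<forall>x \<in> carrier G. (f \<circ> ad G) x = 0) \<longleftrightarrow> (\<forall>\<phi> \<in> Inn G. f \<phi> = 0))"
proof -
  interpret group G
    by (rule assms(1))
  interpret ad: group_hom G "AutoGroup G" "ad G"
    by (rule group_hom_ad)
  \<comment> \<open>By \<open>ad_auto_image\<close>, \<open>ad G (\<phi> x)\<close> and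
    \<open>ad G x\<close> are conjugate in \<open>AutoGroup G\<close>, so \<open>Qh_conj\<close>,
    applied in that group, gives them the same value under \<open>f\<close>.\<close>
  have "Aut_invariant G (f \<circ> ad G)"
    using assms(2) by (simp add: Aut_invariant_def ad_auto_image ad_in_auto ad.H.Qh_conj)
  then show ?thesis
    using assms(2) by (simp add: ad.Qh_comp Inn_def)
qed

end
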